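(* Let $n\ge 1$ and let $f:\{-1,1\}^n\to\{-1,1\}$ be an $m$-sparse Boolean function with $1\le m\le 2^{n-2}$. Then $f$ has a polynomial threshold function representation $p=\sum_S w_S\prod_{k\in S}x_k$ with integer coefficients, of length at most $m+2^{n-1}$, and with weight $\sum_S|w_S|\le 3\times 2^{\,2n+0.5\,m\log_2 m-m+1.5\log_2 m}$.
   Context: A Boolean function $f:\{-1,1\}^n\to\{-1,1\}$ is called $m$-sparse if $m=\min(|f^{-1}(1)|,|f^{-1}(-1)|)$ (the informal requirement that $m$ be small compared with $2^n$ is replaced by the explicit hypothesis on $m$ in the statement). A multilinear polynomial $p(x)=\sum_{S\subseteq\{1,\dots,n\}} w_S\prod_{k\in S}x_k$ is a polynomial threshold function (PTF) representation of $f$ if $f(x)=\operatorname{sgn}(p(x))$ for all $x\in\{-1,1\}^n$; in particular $p(x)\neq 0$ for all such $x$. Its length is the number of non-zero coefficients $w_S$. *)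

theory Defs
  imports Complex_Main "HOL-Library.FuncSet"
begin

definition cube :: "nat \<Rightarrow> (nat \<Rightarrow> real) set" where
  "cube n = {1..n} \<rightarrow>\<^sub>E {-1, 1}"

definition boolean_function :: "nat \<Rightarrow> ((nat \<Rightarrow> real) \<Rightarrow> real) \<Rightarrow> bool" where
  "boolean_function n f \<longleftrightarrow> f \<in> cube n \<rightarrow> {-1, 1}"

definition sparse :: "nat \<Rightarrow> nat \<Rightarrow> ((nat \<Rightarrow> real) \<Rightarrow> real) \<Rightarrow> bool" where
  "sparse n m f \<longleftrightarrow> m = min (card {x \<in> cube n. f x = 1}) (card {x \<in> cube n. f x = -1})"

text \<open>A multilinear polynomial in the variables with indices \<open>1, ..., n\<close> is given by its
  coefficient family \<open>w\<close>; values of \<open>w\<close> at sets that are not subsets of \<open>{1..n}\<close> are irrelevant.\<close>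

definition multilin_eval :: "nat \<Rightarrow> (nat set \<Rightarrow> real) \<Rightarrow> (nat \<Rightarrow> real) \<Rightarrow> real" where
  "multilin_eval n w x = (\<Sum>S\<in>Pow {1..n}. w S * (\<Prod>k\<in>S. x k))"

text \<open>Here \<open>sgn 0 = 0\<close>, so for a Boolean function \<open>f\<close> a representing polynomial never vanishes
  on the cube.\<close>

definition ptf_represents :: "nat \<Rightarrow> (nat set \<Rightarrow> real) \<Rightarrow> ((nat \<Rightarrow> real) \<Rightarrow> real) \<Rightarrow> bool" where
  "ptf_represents n w f \<longleftrightarrow> (\<forall>x\<in>cube n. f x = sgn (multilin_eval n w x))"

definition ptf_length :: "nat \<Rightarrow> (nat set \<Rightarrow> real) \<Rightarrow> nat" where
  "ptf_length n w = card {S \<in> Pow {1..n}. w S \<noteq> 0}"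

definition ptf_weight :: "nat \<Rightarrow> (nat set \<Rightarrow> real) \<Rightarrow> real" where
  "ptf_weight n w = (\<Sum>S\<in>Pow {1..n}. \<bar>w S\<bar>)"

end

(* Let A be the minority set and write x = (y, t) with t the last coordinate.  The polynomial is
   p(x) = a(y) + t b(y).  Here a(y) = M (1 - number of lifts of y lying in A), with M > max |b|,
   settles the sign of p except over the set of those y having exactly one lift in A, where it
   vanishes.  There are at most m such y, and b interpolates the signs required there using only m
   monomials.  The coefficients of b are given by Cramer's rule: they are determinants of m x m sign
   matrices, which are divisible by 2^(m-1) and at most m^(m/2) by Hadamard's inequality. *)

theory Submission
  imports Defs "Jordan_Normal_Form.Determinant"
begin

section \<open>Hadamard's inequality via Gram determinants\<close>

text \<open>Rectangular matrices make the induction on the number of rows close up. Clearing the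
  components along the last row has determinant 1, so it keeps the Gram determinant; it splits off
  the squared norm of that row and can only shorten the others, which again form a matrix with
  \<open>N\<close> columns.\<close>

lemma det_gram_le_prod_row_norms:
  fixes A :: "real mat"
  assumes "A \<in> carrier_mat k N"
  shows "det (A * A\<^sup>T) \<le> (\<Prod>i<k. \<Sum>l<N. (A $$ (i, l))\<^sup>2)"
  using assms
proof (induction k arbitrary: A)
  case 0
  then show ?case by (simp add: det_def)
next
  case (Suc k A)
  note A = Suc.prems
  define ip where "ip i j = (\<Sum>l<N. A $$ (i, l) * A $$ (j, l))" for i j
  define c where "c i = ip i k / ip k k" for i
  \<comment> \<open>If row \<open>k\<close> is zero, division by zero makes \<open>c i\<close> equal
    to 0; since every \<open>ip i k\<close> vanishes as well, \<open>c_ip\<close> covers this case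
    too.\<close>
  have ip_zero: "ip i k = 0" if z: "ip k k = 0" for i
  proof -
    have "\<forall>l\<in>{..<N}. A $$ (k, l) * A $$ (k, l) = 0"
      using z unfolding ip_def by (subst (asm) sum_nonneg_eq_0_iff) auto
    then show ?thesis unfolding ip_def by (intro sum.neutral) auto
  qed
  have c_ip: "c i * ip k k = ip i k" for i
    using ip_zero[of i] by (cases "ip k k = 0") (auto simp: c_def)
  \<comment> \<open>one Gram-Schmidt step: \<open>P\<close> makes the first \<open>k\<close> rows orthogonal to row \<open>k\<close>\<close>
  define P where "P = mat (Suc k) (Suc k) (\<lambda>(i, j). if i = j then 1 else if j = k then - c i else 0)"
  have P: "P \<in> carrier_mat (Suc k) (Suc k)" by (simp add: P_def)
  have "upper_triangular P" by (auto simp: P_def upper_triangular_def)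
  then have "det P = prod_list (diag_mat P)" using P by (rule det_upper_triangular)
  also have "\<dots> = 1" by (simp add: prod_list_diag_prod P_def)
  finally have detP: "det P = 1" .
  define U where "U = P * A"
  have U: "U \<in> carrier_mat (Suc k) N" using P A by (simp add: U_def)
  have U_lt: "U $$ (i, l) = A $$ (i, l) - c i * A $$ (k, l)" if "i < k" "l < N" for i l
  proof -
    have "U $$ (i, l) = (\<Sum>j\<in>{0..<Suc k}. P $$ (i, j) * A $$ (j, l))"
      using that A P by (simp add: U_def scalar_prod_def)
    moreover have "(\<Sum>j\<in>{0..<k}. P $$ (i, j) * A $$ (j, l)) = (\<Sum>j\<in>{0..<k}. if j = i then A $$ (i, l) else 0)"
      using that by (intro sum.cong) (auto simp: P_def)
    ultimately show ?thesis using that by (simp add: P_def)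
  qed
  have U_k: "U $$ (k, l) = A $$ (k, l)" if "l < N" for l
  proof -
    have "U $$ (k, l) = (\<Sum>j\<in>{0..<Suc k}. P $$ (k, j) * A $$ (j, l))"
      using that A P by (simp add: U_def scalar_prod_def)
    also have "\<dots> = A $$ (k, l)" by (simp add: P_def)
    finally show ?thesis .
  qed
  have "U * U\<^sup>T = P * (A * A\<^sup>T) * P\<^sup>T"
    using P A unfolding U_def
    by (simp add: transpose_mult assoc_mult_mat[of _ "Suc k" "Suc k" _ N _ "Suc k"]
        assoc_mult_mat[of _ "Suc k" "Suc k" _ "Suc k" _ "Suc k"] assoc_mult_mat[of _ "Suc k" N _ "Suc k" _ "Suc k"])
  then have "det (A * A\<^sup>T) = det (U * U\<^sup>T)"
    using P A detP by (simp add: det_mult[of _ "Suc k"] det_transpose)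
  \<comment> \<open>By orthogonality the last column of \<open>U * U\<^sup>T\<close> is zero off the
    diagonal, so the expansion along it keeps a single cofactor, which is the Gram determinant of
    the first \<open>k\<close> rows of \<open>U\<close>.\<close>
  also have "\<dots> = (\<Sum>i<Suc k. (U * U\<^sup>T) $$ (i, k) * cofactor (U * U\<^sup>T) i k)"
    by (rule laplace_expansion_column) (use U in auto)
  also have "\<dots> = (U * U\<^sup>T) $$ (k, k) * cofactor (U * U\<^sup>T) k k"
  proof -
    have "(U * U\<^sup>T) $$ (i, k) = 0" if "i < k" for i
    proof -
      have "(U * U\<^sup>T) $$ (i, k) = (\<Sum>l<N. (A $$ (i, l) - c i * A $$ (k, l)) * A $$ (k, l))"
        using that U by (auto simp: scalar_prod_def U_lt U_k atLeast0LessThan intro!: sum.cong)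
      also have "\<dots> = ip i k - c i * ip k k"
        by (simp add: ip_def algebra_simps sum_subtractf sum_distrib_left)
      finally show ?thesis by (simp add: c_ip)
    qed
    then show ?thesis by simp
  qed
  also have "(U * U\<^sup>T) $$ (k, k) = (\<Sum>l<N. (A $$ (k, l))\<^sup>2)"
    using U by (auto simp: scalar_prod_def U_k atLeast0LessThan power2_eq_square intro!: sum.cong)
  also have "cofactor (U * U\<^sup>T) k k = det (mat k N (\<lambda>(i, l). U $$ (i, l)) * (mat k N (\<lambda>(i, l). U $$ (i, l)))\<^sup>T)"
  proof -
    have "mat_delete (U * U\<^sup>T) k k = mat k N (\<lambda>(i, l). U $$ (i, l)) * (mat k N (\<lambda>(i, l). U $$ (i, l)))\<^sup>T"
      using U by (auto simp: mat_delete_def scalar_prod_def intro!: eq_matI sum.cong)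
    then show ?thesis by (simp add: cofactor_def)
  qed
  also have "(\<Sum>l<N. (A $$ (k, l))\<^sup>2) * det (mat k N (\<lambda>(i, l). U $$ (i, l)) * (mat k N (\<lambda>(i, l). U $$ (i, l)))\<^sup>T)
    \<le> (\<Sum>l<N. (A $$ (k, l))\<^sup>2) * (\<Prod>i<k. \<Sum>l<N. (mat k N (\<lambda>(i, l). U $$ (i, l)) $$ (i, l))\<^sup>2)"
    by (intro mult_left_mono Suc.IH sum_nonneg) auto
  also have "\<dots> \<le> (\<Sum>l<N. (A $$ (k, l))\<^sup>2) * (\<Prod>i<k. \<Sum>l<N. (A $$ (i, l))\<^sup>2)"
  proof (intro mult_left_mono prod_mono sum_nonneg conjI)
    fix i assume "i \<in> {..<k}"
    then have "(\<Sum>l<N. (mat k N (\<lambda>(i, l). U $$ (i, l)) $$ (i, l))\<^sup>2) = (\<Sum>l<N. (A $$ (i, l) - c i * A $$ (k, l))\<^sup>2)"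
      by (intro sum.cong) (auto simp: U_lt)
    \<comment> \<open>Pythagoras: removing the projection onto row \<open>k\<close> lowers the
      squared norm by \<open>(c i)\<^sup>2 * ip k k\<close>, which is nonnegative.\<close>
    also have "\<dots> = (\<Sum>l<N. (A $$ (i, l))\<^sup>2) - c i * (2 * ip i k - c i * ip k k)"
      by (simp add: ip_def algebra_simps power2_eq_square sum_subtractf sum.distrib sum_distrib_left)
    also have "\<dots> = (\<Sum>l<N. (A $$ (i, l))\<^sup>2) - (c i)\<^sup>2 * ip k k"
      by (simp add: c_ip[symmetric, of i] power2_eq_square algebra_simps)
    also have "\<dots> \<le> (\<Sum>l<N. (A $$ (i, l))\<^sup>2)"
      by (simp add: ip_def sum_nonneg)
    finally show "(\<Sum>l<N. (mat k N (\<lambda>(i, l). U $$ (i, l)) $$ (i, l))\<^sup>2) \<le> (\<Sum>l<N. (A $$ (i, l))\<^sup>2)" .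
  qed auto
  finally show ?case by (simp add: mult.commute)
qed

lemma hadamard_inequality:
  fixes A :: "real mat"
  assumes A: "A \<in> carrier_mat n n"
  shows "(det A)\<^sup>2 \<le> (\<Prod>i<n. \<Sum>l<n. (A $$ (i, l))\<^sup>2)"
proof -
  have "(det A)\<^sup>2 = det (A * A\<^sup>T)"
    using A by (simp add: det_mult[of _ n] det_transpose power2_eq_square)
  then show ?thesis using det_gram_le_prod_row_norms[OF A] by simp
qed

lemma det_sign_matrix_bound:
  fixes A :: "real mat"
  assumes A: "A \<in> carrier_mat n n"
    and pm: "\<And>i j. i < n \<Longrightarrow> j < n \<Longrightarrow> A $$ (i, j) \<in> {-1, 1}"
  shows "\<bar>det A\<bar> \<le> sqrt (real n ^ n)"
proof -
  have "(\<Sum>l<n. (A $$ (i, l))\<^sup>2) = real n" if "i < n" for i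
  proof -
    have "(A $$ (i, l))\<^sup>2 = 1" if "l < n" for l
      using pm[OF \<open>i < n\<close> that] by auto
    then show ?thesis by simp
  qed
  then have "(det A)\<^sup>2 \<le> real n ^ n"
    using hadamard_inequality[OF A] by simp
  then show ?thesis using real_le_rsqrt by (metis power2_abs)
qed

section \<open>Integrality of determinants and the power of two dividing them\<close>

lemma det_in_Ints:
  fixes A :: "real mat"
  assumes A: "A \<in> carrier_mat n n"
    and "\<And>i j. i < n \<Longrightarrow> j < n \<Longrightarrow> A $$ (i, j) \<in> \<int>"
  shows "det A \<in> \<int>"
proof -
  have "A $$ (i, p i) \<in> \<int>" if "p permutes {0..<n}" "i < n" for p i
    using assms(2)[of i "p i"] permutes_in_image[OF that(1), of i] that(2) by simp
  then show ?thesis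
    unfolding det_def'[OF A] by (auto intro!: Ints_sum Ints_mult Ints_prod simp: sign_def)
qed

lemma det_sign_matrix_dvd:
  fixes A :: "real mat"
  assumes A: "A \<in> carrier_mat (Suc n) (Suc n)"
    and pm: "\<And>i j. i < Suc n \<Longrightarrow> j < Suc n \<Longrightarrow> A $$ (i, j) \<in> {-1, 1}"
  shows "det A / 2 ^ n \<in> \<int>"
proof -
  \<comment> \<open>subtracting row \<open>0\<close> from the other rows leaves even entries, hence \<open>A = T * C\<close>\<close>
  define T :: "real mat" where
    "T = mat (Suc n) (Suc n) (\<lambda>(i, j). if j = 0 then 1 else if i = j then 2 else 0)"
  define C where
    "C = mat (Suc n) (Suc n) (\<lambda>(i, j). if i = 0 then A $$ (0, j) else (A $$ (i, j) - A $$ (0, j)) / 2)"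
  have T: "T \<in> carrier_mat (Suc n) (Suc n)" and C: "C \<in> carrier_mat (Suc n) (Suc n)"
    by (simp_all add: T_def C_def)
  have "A = T * C"
  proof (rule eq_matI)
    fix i j assume "i < dim_row (T * C)" "j < dim_col (T * C)"
    then have ij: "i < Suc n" "j < Suc n" by (simp_all add: T_def C_def)
    have "(T * C) $$ (i, j) = (\<Sum>l<Suc n. T $$ (i, l) * C $$ (l, j))"
      using ij T C by (simp add: scalar_prod_def atLeast0LessThan)
    also have "\<dots> = A $$ (0, j) + (\<Sum>l<n. T $$ (i, Suc l) * C $$ (Suc l, j))"
      using ij by (subst sum.lessThan_Suc_shift) (simp add: T_def C_def)
    also have "(\<Sum>l<n. T $$ (i, Suc l) * C $$ (Suc l, j))
        = (\<Sum>l<n. if i = Suc l then A $$ (i, j) - A $$ (0, j) else 0)"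
      using ij by (intro sum.cong) (auto simp: T_def C_def)
    also have "A $$ (0, j) + \<dots> = A $$ (i, j)"
      using ij by (cases i) auto
    finally show "A $$ (i, j) = (T * C) $$ (i, j)" by simp
  qed (use A in \<open>simp_all add: T_def C_def\<close>)
  then have "det A = det T * det C" using det_mult[OF T C] by simp
  also have "det T = prod_list (diag_mat T)"
    by (rule det_lower_triangular[OF _ T]) (auto simp: T_def)
  also have "\<dots> = 2 ^ n"
    by (simp add: prod_list_diag_prod T_def atLeast0LessThan prod.lessThan_Suc_shift del: prod.lessThan_Suc)
  finally have "det A / 2 ^ n = det C" by simp
  \<comment> \<open>Two signs differ by -2, 0 or 2, so the halved differences are integers.\<close>
  moreover have "det C \<in> \<int>"
  proof (rule det_in_Ints[OF C])
    fix i j assume ij: "i < Suc n" "j < Suc n"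
    then show "C $$ (i, j) \<in> \<int>"
      using pm[of i j] pm[of 0 j] by (auto simp: C_def)
  qed
  ultimately show ?thesis by simp
qed

section \<open>Characters of the cube and sign interpolation\<close>

text \<open>Orthogonality of characters: the sum factors as the product of
  \<open>x k * y k + 1\<close>, and each factor is 2 or 0. It serves both to find independent
  monomials and to expand the indicator of a point.\<close>

lemma sum_Pow_prod_mult_prod:
  fixes x y :: "'a \<Rightarrow> real"
  assumes I: "finite I" and x: "x \<in> I \<rightarrow> {-1, 1}" and y: "y \<in> I \<rightarrow> {-1, 1}"
  shows "(\<Sum>S\<in>Pow I. prod x S * prod y S) = (if \<forall>k\<in>I. x k = y k then 2 ^ card I else 0)"
proof -
  have "(\<Sum>S\<in>Pow I. prod x S * prod y S) = (\<Prod>k\<in>I. x k * y k + 1)"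
    using prod_add[OF I, of "\<lambda>k. x k * y k" "\<lambda>_. 1"] by (simp add: prod.distrib)
  also have "\<dots> = (\<Prod>k\<in>I. if x k = y k then 2 else 0)"
    using x y by (intro prod.cong) (fastforce simp: Pi_def)+
  also have "\<dots> = (if \<forall>k\<in>I. x k = y k then 2 ^ card I else 0)"
    using I by auto
  finally show ?thesis .
qed

lemma abs_prod_sign:
  fixes x :: "'a \<Rightarrow> real"
  assumes "x \<in> S \<rightarrow> {-1, 1}"
  shows "\<bar>prod x S\<bar> = 1"
proof -
  have "\<bar>x k\<bar> = 1" if "k \<in> S" for k
    using assms that by (auto simp: Pi_def)
  then show ?thesis by (simp add: abs_prod)
qed

lemma prod_sign_cases:
  fixes x :: "'a \<Rightarrow> real"
  assumes "x \<in> S \<rightarrow> {-1, 1}"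
  shows "prod x S \<in> {-1, 1}"
  using abs_prod_sign[OF assms] by (auto simp: abs_if split: if_splits)

text \<open>The monomials span all functions on a set of distinct points, so enough independent
  columns exist. They are chosen greedily: each new point comes with a monomial that keeps the
  determinant nonzero.\<close>

lemma nonsingular_monomial_matrix:
  fixes y :: "nat \<Rightarrow> 'a \<Rightarrow> real"
  assumes I: "finite I"
    and y: "\<And>i. i < m \<Longrightarrow> y i \<in> I \<rightarrow> {-1, 1}"
    and dist: "\<And>i j. i < j \<Longrightarrow> j < m \<Longrightarrow> \<exists>k\<in>I. y i k \<noteq> y j k"
  shows "\<exists>S. (\<forall>j<m. S j \<subseteq> I) \<and> det (mat m m (\<lambda>(i, j). prod (y i) (S j))) \<noteq> 0"
  using y dist
proof (induction m)
  case 0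
  then show ?case by (simp add: det_def)
next
  case (Suc m)
  then obtain S where S: "\<And>j. j < m \<Longrightarrow> S j \<subseteq> I"
    and det: "det (mat m m (\<lambda>(i, j). prod (y i) (S j))) \<noteq> 0"
    by auto
  \<comment> \<open>\<open>Z\<close> is the candidate for the new column. The cofactors along that
    column do not involve \<open>Z\<close>, so the determinant is a fixed linear combination of the
    values \<open>prod (y i) Z\<close>.\<close>
  define M where "M Z = mat (Suc m) (Suc m) (\<lambda>(i, j). prod (y i) ((S(m := Z)) j))" for Z
  define cf where "cf i = cofactor (M {}) i m" for i
  have cf: "cofactor (M Z) i m = cf i" for Z i
  proof -
    have "mat_delete (M Z) i m = mat_delete (M {}) i m"
      by (rule eq_matI) (auto simp: M_def mat_delete_def)
    then show ?thesis by (simp add: cofactor_def cf_def)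
  qed
  have "mat_delete (M {}) m m = mat m m (\<lambda>(i, j). prod (y i) (S j))"
    by (rule eq_matI) (auto simp: M_def mat_delete_def)
  then have cfm: "cf m \<noteq> 0"
    using det by (simp add: cf_def cofactor_def)
  have detM: "det (M Z) = (\<Sum>i<Suc m. prod (y i) Z * cf i)" for Z
    using laplace_expansion_column[of "M Z" "Suc m" m]
    by (simp only: cf) (simp add: M_def)
  \<comment> \<open>as a function of the last column's monomial, the determinant pairs with the character
    of \<open>y m\<close> to \<open>cf m * 2 ^ card I\<close>\<close>
  have "\<exists>Z\<in>Pow I. det (M Z) \<noteq> 0"
  proof (rule ccontr)
    assume "\<not> ?thesis"
    then have "0 = (\<Sum>Z\<in>Pow I. prod (y m) Z * det (M Z))" by simp
    also have "\<dots> = (\<Sum>i<Suc m. cf i * (\<Sum>Z\<in>Pow I. prod (y m) Z * prod (y i) Z))"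
      unfolding detM sum_distrib_left by (subst sum.swap) (simp add: mult_ac)
    also have "\<dots> = (\<Sum>i<Suc m. cf i * (if i = m then 2 ^ card I else 0))"
    proof (intro sum.cong refl)
      fix i assume "i \<in> {..<Suc m}"
      then have "(\<forall>k\<in>I. y m k = y i k) \<longleftrightarrow> i = m"
        using Suc.prems(2)[of i m] by (cases "i = m") force+
      then show "cf i * (\<Sum>Z\<in>Pow I. prod (y m) Z * prod (y i) Z) = cf i * (if i = m then 2 ^ card I else 0)"
        using \<open>i \<in> {..<Suc m}\<close> Suc.prems(1)
        by (simp add: sum_Pow_prod_mult_prod[OF I, of "y m" "y i"])
    qed
    also have "\<dots> = cf m * 2 ^ card I" by simp
    finally show False using cfm by simp
  qed
  then obtain Z where Z: "Z \<subseteq> I" "det (M Z) \<noteq> 0" by blast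
  show ?case
  proof (intro exI conjI)
    show "\<forall>j<Suc m. (S(m := Z)) j \<subseteq> I" using S Z by (auto simp: less_Suc_eq)
    show "det (mat (Suc m) (Suc m) (\<lambda>(i, j). prod (y i) ((S(m := Z)) j))) \<noteq> 0"
      using Z by (simp add: M_def)
  qed
qed

text \<open>Cramer's rule solves the system with right-hand side \<open>s\<close> for a nonsingular
  monomial matrix. Scaling the solution by the positive number
  \<open>\<bar>det A\<bar> / 2 ^ (m - 1)\<close> preserves signs and makes the coefficients
  integral; the exponent \<open>m - 1\<close> accounts for the factor 2 in the bound.\<close>

lemma sign_interpolation:
  fixes y :: "nat \<Rightarrow> 'a \<Rightarrow> real" and s :: "nat \<Rightarrow> real"
  assumes I: "finite I" and m: "m \<ge> 1"
    and y: "\<And>i. i < m \<Longrightarrow> y i \<in> I \<rightarrow> {-1, 1}"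
    and dist: "\<And>i j. i < j \<Longrightarrow> j < m \<Longrightarrow> \<exists>k\<in>I. y i k \<noteq> y j k"
    and s: "\<And>i. i < m \<Longrightarrow> s i \<in> {-1, 1}"
  obtains S c where "\<And>j. j < m \<Longrightarrow> S j \<subseteq> I" "\<And>j. j < m \<Longrightarrow> c j \<in> \<int>"
    "\<And>i. i < m \<Longrightarrow> 0 < s i * (\<Sum>j<m. c j * prod (y i) (S j))"
    "(\<Sum>j<m. \<bar>c j\<bar>) \<le> 2 * real m * sqrt (real m ^ m) / 2 ^ m"
proof -
  obtain S where S: "\<And>j. j < m \<Longrightarrow> S j \<subseteq> I"
    and detS: "det (mat m m (\<lambda>(i, j). prod (y i) (S j))) \<noteq> 0"
    using nonsingular_monomial_matrix[of I m y, OF I y dist] by auto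
  obtain r where r: "m = Suc r" using m by (cases m) auto
  define A where "A = mat m m (\<lambda>(i, j). prod (y i) (S j))"
  have A: "A \<in> carrier_mat m m" by (simp add: A_def)
  have dA: "det A \<noteq> 0" using detS by (simp add: A_def)
  have A_pm: "A $$ (i, j) \<in> {-1, 1}" if "i < m" "j < m" for i j
    using prod_sign_cases[of "y i" "S j"] y[OF that(1)] S[OF that(2)] that by (auto simp: A_def)
  define b where "b = vec m s"
  have b: "b \<in> carrier_vec m" by (simp add: b_def)
  \<comment> \<open>Replacing a column by a vector of signs leaves a sign matrix, so the
    divisibility and the Hadamard bound apply to every numerator in Cramer's rule.\<close>
  define R where "R j = replace_col A b j" for j
  have R: "R j \<in> carrier_mat m m" for j using A by (simp add: R_def replace_col_def)
  have R_pm: "R j $$ (i, l) \<in> {-1, 1}" if "i < m" "l < m" for i j l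
    using A_pm[OF that] s[OF that(1)] that A by (auto simp: R_def replace_col_def b_def)
  \<comment> \<open>\<open>cramer_lemma_mat\<close> starts from a solution of the system, so one is
    built from the adjugate.\<close>
  define x where "x = (1 / det A) \<cdot>\<^sub>v (adj_mat A *\<^sub>v b)"
  have x: "x \<in> carrier_vec m" using adj_mat(1)[OF A] b by (simp add: x_def)
  have "A *\<^sub>v x = (1 / det A) \<cdot>\<^sub>v (A *\<^sub>v (adj_mat A *\<^sub>v b))"
    unfolding x_def by (rule mult_mat_vec[OF A]) (use adj_mat(1)[OF A] b in simp)
  also have "A *\<^sub>v (adj_mat A *\<^sub>v b) = det A \<cdot>\<^sub>m 1\<^sub>m m *\<^sub>v b"
    using assoc_mult_mat_vec[OF A adj_mat(1)[OF A] b] adj_mat(2)[OF A] by simp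
  also have "\<dots> = det A \<cdot>\<^sub>v b"
    using b by (auto intro!: eq_vecI simp: scalar_prod_def if_distrib[where f = "\<lambda>z. _ * z"]
          if_distrib[where f = "\<lambda>z. z * _"] cong: if_cong)
  finally have Ax: "A *\<^sub>v x = b" using dA by (simp add: smult_smult_assoc)
  have cramer: "det (R j) = x $ j * det A" if "j < m" for j
    using cramer_lemma_mat[OF A x that] by (simp add: Ax R_def)
  \<comment> \<open>The factor \<open>sgn (det A)\<close> turns the scaling of \<open>x\<close> into
    multiplication by \<open>\<bar>det A\<bar> / 2 ^ r\<close>, which is positive; here
    \<open>r = m - 1\<close>.\<close>
  define c where "c j = sgn (det A) * (det (R j) / 2 ^ r)" for j
  show ?thesis
  proof (rule that[of S c])
    show "S j \<subseteq> I" if "j < m" for j using S that .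
    show "c j \<in> \<int>" if "j < m" for j
    proof -
      have "det (R j) / 2 ^ r \<in> \<int>"
        using det_sign_matrix_dvd[of "R j" r] R R_pm by (simp add: r)
      then show ?thesis by (auto simp: c_def sgn_if)
    qed
    show "0 < s i * (\<Sum>j<m. c j * prod (y i) (S j))" if i: "i < m" for i
    proof -
      have "s i = (A *\<^sub>v x) $ i" using i by (simp add: Ax b_def)
      also have "\<dots> = (\<Sum>j<m. x $ j * prod (y i) (S j))"
        using i x by (auto simp: A_def scalar_prod_def atLeast0LessThan mult.commute intro!: sum.cong)
      finally have si: "s i = (\<Sum>j<m. x $ j * prod (y i) (S j))" .
      have "(\<Sum>j<m. c j * prod (y i) (S j)) = (\<Sum>j<m. \<bar>det A\<bar> / 2 ^ r * (x $ j * prod (y i) (S j)))"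
        by (intro sum.cong refl) (simp add: c_def cramer abs_sgn)
      also have "\<dots> = \<bar>det A\<bar> / 2 ^ r * s i"
        by (simp only: sum_distrib_left[symmetric] si[symmetric])
      finally have "s i * (\<Sum>j<m. c j * prod (y i) (S j)) = (s i * s i) * (\<bar>det A\<bar> / 2 ^ r)"
        by simp
      moreover have "s i * s i = 1" using s[OF i] by auto
      ultimately show ?thesis using dA by simp
    qed
    have "\<bar>c j\<bar> \<le> sqrt (real m ^ m) / 2 ^ r" if "j < m" for j
      using det_sign_matrix_bound[OF R R_pm, of j] dA
      by (simp add: c_def abs_mult abs_sgn_eq divide_right_mono)
    then have "(\<Sum>j<m. \<bar>c j\<bar>) \<le> (\<Sum>j<m. sqrt (real m ^ m) / 2 ^ r)"
      by (intro sum_mono) simp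
    moreover have "(2 :: real) ^ m = 2 * 2 ^ r" by (simp add: r)
    ultimately show "(\<Sum>j<m. \<bar>c j\<bar>) \<le> 2 * real m * sqrt (real m ^ m) / 2 ^ m"
      by simp
  qed
qed

section \<open>The cube and splitting off the last coordinate\<close>

lemma finite_cube: "finite (cube n)"
  by (simp add: cube_def finite_PiE)

lemma card_cube: "card (cube n) = 2 ^ n"
  by (simp add: cube_def card_PiE numeral_2_eq_2[symmetric])

lemma cube_sign: "x \<in> cube n \<Longrightarrow> I \<subseteq> {1..n} \<Longrightarrow> x \<in> I \<rightarrow> {-1, 1}"
  unfolding cube_def by fastforce

lemma cube_eqI:
  assumes "x \<in> cube n" "y \<in> cube n" "\<And>k. k \<in> {1..n} \<Longrightarrow> x k = y k"
  shows "x = y"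
  using assms unfolding cube_def by (rule PiE_ext)

lemma restrict_cube: "x \<in> cube (Suc N) \<Longrightarrow> restrict x {1..N} \<in> cube N"
  unfolding cube_def by (fastforce simp: PiE_def)

lemma fun_upd_cube: "x \<in> cube N \<Longrightarrow> t \<in> {-1, 1} \<Longrightarrow> x(Suc N := t) \<in> cube (Suc N)"
  unfolding cube_def by (auto simp: PiE_iff extensional_def)

lemma sum_Pow_Suc:
  "sum F (Pow {1..Suc N}) = sum F (Pow {1..N}) + (\<Sum>S\<in>Pow {1..N}. F (insert (Suc N) S))"
proof -
  have "inj_on (insert (Suc N)) (Pow {1..N})"
  proof (rule inj_onI)
    fix S T assume "S \<in> Pow {1..N}" "T \<in> Pow {1..N}" "insert (Suc N) S = insert (Suc N) T"
    moreover from this(1,2) have "Suc N \<notin> S" "Suc N \<notin> T" by auto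
    ultimately show "S = T" by (simp add: insert_ident)
  qed
  moreover have "Pow {1..Suc N} = Pow {1..N} \<union> insert (Suc N) ` Pow {1..N}"
    by (simp add: atLeastAtMostSuc_conv Pow_insert)
  moreover have "Pow {1..N} \<inter> insert (Suc N) ` Pow {1..N} = {}" by auto
  ultimately show ?thesis by (simp add: sum.union_disjoint sum.reindex)
qed

lemma multilin_eval_Suc:
  "multilin_eval (Suc N) w x
    = multilin_eval N w x + x (Suc N) * multilin_eval N (\<lambda>S. w (insert (Suc N) S)) x"
proof -
  have "prod x (insert (Suc N) S) = x (Suc N) * prod x S" if "S \<in> Pow {1..N}" for S
    using that by (subst prod.insert) (auto intro: finite_subset)
  then show ?thesis
    unfolding multilin_eval_def sum_Pow_Suc sum_distrib_left by (auto intro!: sum.cong)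
qed

text \<open>Writing the coefficient at \<open>T\<close> as a sum over all \<open>j\<close> lets the
  contributions of coinciding sets \<open>S j\<close> add up.\<close>

lemma multilin_eval_monomials:
  assumes "\<And>j. j < m \<Longrightarrow> S j \<subseteq> {1..N}"
  shows "multilin_eval N (\<lambda>T. \<Sum>j<m. if S j = T then c j else 0) x = (\<Sum>j<m. c j * prod x (S j))"
proof -
  have "multilin_eval N (\<lambda>T. \<Sum>j<m. if S j = T then c j else 0) x
      = (\<Sum>j<m. \<Sum>T\<in>Pow {1..N}. if S j = T then c j * prod x T else 0)"
    unfolding multilin_eval_def sum_distrib_right by (subst sum.swap) (intro sum.cong, auto)
  also have "\<dots> = (\<Sum>j<m. c j * prod x (S j))"
    using assms by (intro sum.cong refl) simp
  finally show ?thesis .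
qed

text \<open>Only the last coordinate is free in the fibre. This turns the count that character
  orthogonality produces into a distinction between zero, one and two lifts in
  \<open>A\<close>.\<close>

lemma card_cube_fibre:
  assumes A: "A \<subseteq> cube (Suc N)" and x: "x \<in> cube (Suc N)"
  shows "card {p \<in> A. \<forall>k\<in>{1..N}. p k = x k}
    = (if x(Suc N := 1) \<in> A then 1 else 0) + (if x(Suc N := -1) \<in> A then 1 else 0)"
proof -
  have "{p \<in> A. \<forall>k\<in>{1..N}. p k = x k} = A \<inter> {x(Suc N := 1), x(Suc N := -1)}"
  proof (intro subset_antisym subsetI)
    fix p assume "p \<in> {p \<in> A. \<forall>k\<in>{1..N}. p k = x k}"
    then have p: "p \<in> A" "p \<in> cube (Suc N)" and eq: "\<And>k. k \<in> {1..N} \<Longrightarrow> p k = x k"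
      using A by auto
    have "p = x(Suc N := p (Suc N))"
      using p(2) x eq unfolding cube_def
      by (auto simp: fun_eq_iff PiE_iff extensional_def)
        (metis le_SucE)
    moreover have "p (Suc N) \<in> {-1, 1}"
      using p(2) unfolding cube_def by (auto simp: PiE_iff)
    ultimately have "p \<in> {x(Suc N := 1), x(Suc N := -1)}" by force
    then show "p \<in> A \<inter> {x(Suc N := 1), x(Suc N := -1)}" using p by blast
  qed auto
  moreover have "x(Suc N := 1) \<noteq> x(Suc N := -1)"
    by (auto dest!: fun_cong[of _ _ "Suc N"])
  ultimately show ?thesis by (auto simp: Int_insert_right)
qed

section \<open>Construction of the polynomial\<close>

text \<open>\<open>W\<close> stands for the total weight of the interpolating part; exposing it
  keeps the numerical estimate separate from the construction.\<close>

lemma ptf_separating_set: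
  assumes A: "A \<subseteq> cube (Suc N)" and card_A: "card A = m" and m: "1 \<le> m" "m \<le> 2 ^ N"
  obtains w :: "nat set \<Rightarrow> real" and W :: real where "\<And>S. S \<subseteq> {1..Suc N} \<Longrightarrow> w S \<in> \<int>"
    "\<And>x. x \<in> cube (Suc N) \<Longrightarrow> sgn (multilin_eval (Suc N) w x) = (if x \<in> A then -1 else 1)"
    "ptf_length (Suc N) w \<le> m + 2 ^ N"
    "ptf_weight (Suc N) w \<le> (W + 1) * 2 ^ N * (1 + real m) + W"
    "W \<le> 2 * real m * sqrt (real m ^ m) / 2 ^ m"
proof -
  let ?I = "{1..N}"
  have fin_A: "finite A" using A finite_cube finite_subset by blast
  define D where "D = {y \<in> cube N. (y(Suc N := 1) \<in> A) \<noteq> (y(Suc N := -1) \<in> A)}"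
  \<comment> \<open>Each point of \<open>D\<close> has a lift in \<open>A\<close>, hence is the
    restriction of a point of \<open>A\<close>; this bounds its cardinality by
    \<open>m\<close>.\<close>
  have "D \<subseteq> (\<lambda>x. restrict x ?I) ` A"
  proof
    fix y assume y: "y \<in> D"
    then have "restrict (y(Suc N := t)) ?I = y" for t
      unfolding D_def cube_def by (auto simp: PiE_iff fun_eq_iff extensional_def restrict_def)
    then show "y \<in> (\<lambda>x. restrict x ?I) ` A"
      using y unfolding D_def by (smt (verit) image_iff mem_Collect_eq)
  qed
  then have "card D \<le> m"
    using card_A fin_A by (metis surj_card_le)
  moreover have "m \<le> card (cube N)" using m by (simp add: card_cube)
  moreover have "D \<subseteq> cube N" by (auto simp: D_def)
  \<comment> \<open>\<open>D\<close> may be smaller than \<open>m\<close>, even empty; padding it to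
    exactly \<open>m\<close> points allows interpolation by an \<open>m\<close> by \<open>m\<close>
    system.\<close>
  ultimately obtain D' where D': "D \<subseteq> D'" "D' \<subseteq> cube N" "card D' = m"
    using exists_subset_between[of D m "cube N"] finite_cube by metis
  obtain y where y: "bij_betw y {0..<m} D'"
    using ex_bij_betw_nat_finite[of D'] D' finite_subset[OF D'(2) finite_cube] by metis
  have y_cube: "y i \<in> cube N" if "i < m" for i
    using y D'(2) that by (auto simp: bij_betw_def)
  have y_dist: "\<exists>k\<in>?I. y i k \<noteq> y j k" if "i < j" "j < m" for i j
  proof (rule ccontr)
    assume "\<not> ?thesis"
    then have "y i = y j" using that by (intro cube_eqI[OF y_cube y_cube]) auto
    then show False using that y by (auto simp: bij_betw_def dest: inj_onD)
  qed
  \<comment> \<open>The sign wanted at last coordinate 1. Over \<open>D\<close> the other lift needs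
    the opposite sign, which the factor \<open>x (Suc N)\<close> supplies; at padding points the
    sign is immaterial.\<close>
  define s :: "nat \<Rightarrow> real" where "s i = (if (y i)(Suc N := 1) \<in> A then -1 else 1)" for i
  obtain S c where S: "\<And>j. j < m \<Longrightarrow> S j \<subseteq> ?I" and c: "\<And>j. j < m \<Longrightarrow> c j \<in> \<int>"
    and pos: "\<And>i. i < m \<Longrightarrow> 0 < s i * (\<Sum>j<m. c j * prod (y i) (S j))"
    and c_sum: "(\<Sum>j<m. \<bar>c j\<bar>) \<le> 2 * real m * sqrt (real m ^ m) / 2 ^ m"
  proof (rule sign_interpolation[of ?I m y s])
    show "y i \<in> ?I \<rightarrow> {-1, 1}" if "i < m" for i
      using cube_sign[OF y_cube[OF that]] by blast
    show "s i \<in> {-1, 1}" for i by (simp add: s_def)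
  qed (use m y_dist in auto)
  define W where "W = (\<Sum>j<m. \<bar>c j\<bar>)"
  have W0: "0 \<le> W" by (simp add: W_def sum_nonneg)
  have W_int: "W \<in> \<int>" using c by (auto simp: W_def intro!: Ints_sum)
  \<comment> \<open>Fourier coefficients of \<open>(W + 1) * 2 ^ N * (1 - h x)\<close>: the constant
    sits at the empty set, each \<open>p\<close> in \<open>A\<close> contributes its character, and
    the factor \<open>2 ^ N\<close> clears the denominators.\<close>
  define a where "a T = (W + 1) * ((if T = {} then 2 ^ N else 0) - (\<Sum>p\<in>A. prod p T))" for T
  define b where "b T = (\<Sum>j<m. if S j = T then c j else 0)" for T
  define w where "w T = (if Suc N \<in> T then b (T - {Suc N}) else a T)" for T
  have w_a: "w T = a T" and w_b: "w (insert (Suc N) T) = b T" if "T \<in> Pow ?I" for T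
  proof -
    have "Suc N \<notin> T" using that by auto
    then show "w T = a T" "w (insert (Suc N) T) = b T" by (simp_all add: w_def)
  qed
  define B where "B x = (\<Sum>j<m. c j * prod x (S j))" for x
  define h where "h x = real (card {p \<in> A. \<forall>k\<in>?I. p k = x k})" for x
  have sign: "x \<in> T \<rightarrow> {-1, 1}" if "x \<in> cube (Suc N)" "T \<subseteq> ?I" for x T
    using that by (intro cube_sign[OF that(1)]) auto
  have eval_a: "multilin_eval N w x = (W + 1) * 2 ^ N * (1 - h x)" if x: "x \<in> cube (Suc N)" for x
  proof -
    have "multilin_eval N w x = (\<Sum>T\<in>Pow ?I. a T * prod x T)"
      unfolding multilin_eval_def by (intro sum.cong refl) (simp add: w_a)
    also have "\<dots> = (W + 1) * ((\<Sum>T\<in>Pow ?I. (if T = {} then 2 ^ N else 0) * prod x T)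
        - (\<Sum>p\<in>A. \<Sum>T\<in>Pow ?I. prod p T * prod x T))"
      unfolding a_def sum.swap[of _ _ A]
      by (simp add: sum_distrib_left sum_distrib_right sum_subtractf algebra_simps)
    also have "(\<Sum>T\<in>Pow ?I. (if T = {} then 2 ^ N else 0) * prod x T) = (\<Sum>T\<in>Pow ?I. if T = {} then 2 ^ N else 0)"
      by (intro sum.cong) auto
    also have "\<dots> = (2 :: real) ^ N" by simp
    also have "(\<Sum>p\<in>A. \<Sum>T\<in>Pow ?I. prod p T * prod x T) = (\<Sum>p\<in>A. if \<forall>k\<in>?I. p k = x k then 2 ^ N else 0)"
      using A x sign by (intro sum.cong refl, subst sum_Pow_prod_mult_prod) auto
    also have "\<dots> = 2 ^ N * h x"
      using fin_A by (simp add: sum.If_cases h_def Int_def)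
    finally show ?thesis by (simp add: algebra_simps)
  qed
  have eval_b: "multilin_eval N (\<lambda>T. w (insert (Suc N) T)) x = B x" for x
  proof -
    have "multilin_eval N (\<lambda>T. w (insert (Suc N) T)) x = multilin_eval N b x"
      unfolding multilin_eval_def by (intro sum.cong refl) (simp add: w_b)
    then show ?thesis
      using multilin_eval_monomials[where S = S and m = m and c = c and x = x, OF S] by (simp add: b_def[abs_def] B_def)
  qed
  have eval: "multilin_eval (Suc N) w x = (W + 1) * 2 ^ N * (1 - h x) + x (Suc N) * B x"
    if "x \<in> cube (Suc N)" for x
    using that by (simp add: multilin_eval_Suc eval_a eval_b)
  show ?thesis
  proof (rule that[of w W])
    show "w T \<in> \<int>" if "T \<subseteq> {1..Suc N}" for T
    proof -
      have "(\<Sum>p\<in>A. prod p T) \<in> \<int>"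
      proof (rule Ints_sum)
        fix p assume "p \<in> A"
        then have "prod p T \<in> {-1, 1}"
          using A that by (intro prod_sign_cases cube_sign) auto
        then show "prod p T \<in> \<int>" by auto
      qed
      then have "a T \<in> \<int>" using W_int by (auto simp: a_def intro!: Ints_mult Ints_diff Ints_add)
      moreover have "b T' \<in> \<int>" for T' using c by (auto simp: b_def intro!: Ints_sum)
      ultimately show ?thesis by (simp add: w_def)
    qed
    show "sgn (multilin_eval (Suc N) w x) = (if x \<in> A then -1 else 1)" if x: "x \<in> cube (Suc N)" for x
    proof -
      have x_last: "x (Suc N) = 1 \<or> x (Suc N) = -1"
        using cube_sign[OF x, of "{Suc N}"] by auto
      have x_upd: "x(Suc N := x (Suc N)) = x" by simp
      have "\<bar>B x\<bar> \<le> (\<Sum>j<m. \<bar>c j * prod x (S j)\<bar>)"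
        unfolding B_def by (rule sum_abs)
      also have "\<dots> = W"
        unfolding W_def using x S by (intro sum.cong refl) (simp add: abs_mult abs_prod_sign sign)
      finally have B_le: "\<bar>B x\<bar> \<le> W" .
      then have "\<bar>x (Suc N) * B x\<bar> \<le> W" using x_last by (auto simp: abs_mult)
      also have "W < (W + 1) * 2 ^ N"
      proof -
        have "(W + 1) * 1 \<le> (W + 1) * 2 ^ N" using W0 by (intro mult_left_mono) auto
        then show ?thesis by simp
      qed
      finally have less: "\<bar>x (Suc N) * B x\<bar> < (W + 1) * 2 ^ N" .
      have h: "h x = (if x(Suc N := 1) \<in> A then 1 else 0) + (if x(Suc N := -1) \<in> A then 1 else 0)"
        unfolding h_def card_cube_fibre[OF A x] by simp
      consider (both) "x(Suc N := 1) \<in> A" "x(Suc N := -1) \<in> A"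
        | (none) "x(Suc N := 1) \<notin> A" "x(Suc N := -1) \<notin> A"
        | (one) "(x(Suc N := 1) \<in> A) \<noteq> (x(Suc N := -1) \<in> A)"
        by blast
      then show ?thesis
      proof cases
        case both
        then have "x \<in> A" using x_last x_upd by metis
        moreover have "multilin_eval (Suc N) w x < 0"
          using less both by (simp add: eval[OF x] h abs_less_iff)
        ultimately show ?thesis by simp
      next
        case none
        then have "x \<notin> A" using x_last x_upd by metis
        moreover have "multilin_eval (Suc N) w x > 0"
          using less none by (simp add: eval[OF x] h abs_less_iff)
        ultimately show ?thesis by simp
      next
        case one
        \<comment> \<open>\<open>D\<close> lives in the smaller cube, and the monomials
          \<open>S j\<close> do not see the last coordinate, so \<open>B\<close> agrees at
          \<open>x\<close> and \<open>z\<close>.\<close>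
        define z where "z = restrict x ?I"
        have z_upd: "z(Suc N := t) = x(Suc N := t)" for t
          using x unfolding cube_def z_def
          by (auto simp: fun_eq_iff restrict_def PiE_iff extensional_def)
        have "z \<in> cube N" unfolding z_def by (rule restrict_cube[OF x])
        then have "z \<in> D" using one by (simp add: D_def z_upd)
        then obtain i where i: "i < m" "y i = z"
          using D'(1) y by (auto simp: bij_betw_def)
        have "prod (y i) (S j) = prod x (S j)" if "j < m" for j
          using S[OF that] unfolding i(2) z_def by (intro prod.cong) auto
        then have "B x = (\<Sum>j<m. c j * prod (y i) (S j))" by (simp add: B_def)
        then have pos': "0 < s i * B x" using pos[OF i(1)] by simp
        have ev: "multilin_eval (Suc N) w x = x (Suc N) * B x"
          using one by (auto simp: eval[OF x] h)
        have si: "s i = (if x(Suc N := 1) \<in> A then -1 else 1)"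
          by (simp add: s_def i(2) z_upd)
        from x_last show ?thesis
        proof
          assume t: "x (Suc N) = 1"
          then have "x \<in> A \<longleftrightarrow> x(Suc N := 1) \<in> A" using x_upd by metis
          then show ?thesis using pos' by (auto simp: ev t si split: if_splits)
        next
          assume t: "x (Suc N) = -1"
          then have "x \<in> A \<longleftrightarrow> x(Suc N := 1) \<notin> A" using x_upd one by metis
          then show ?thesis using pos' by (auto simp: ev t si split: if_splits)
        qed
      qed
    qed
    show "ptf_length (Suc N) w \<le> m + 2 ^ N"
    proof -
      \<comment> \<open>At most \<open>m\<close> monomials contain the last variable, and the others
        are among the \<open>2 ^ N\<close> subsets of \<open>?I\<close>.\<close>
      have "{T \<in> Pow {1..Suc N}. w T \<noteq> 0} \<subseteq> (\<lambda>j. insert (Suc N) (S j)) ` {..<m} \<union> Pow ?I"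
      proof
        fix T assume T: "T \<in> {T \<in> Pow {1..Suc N}. w T \<noteq> 0}"
        show "T \<in> (\<lambda>j. insert (Suc N) (S j)) ` {..<m} \<union> Pow ?I"
        proof (cases "Suc N \<in> T")
          case True
          with T have "b (T - {Suc N}) \<noteq> 0" by (simp add: w_def)
          then have "\<exists>j<m. S j = T - {Suc N}"
            unfolding b_def by (rule contrapos_np) (auto intro!: sum.neutral)
          then obtain j where "j < m" "S j = T - {Suc N}" by blast
          then show ?thesis using True by auto
        next
          case False
          then show ?thesis using T by (auto simp: atLeastAtMostSuc_conv)
        qed
      qed
      then have "ptf_length (Suc N) w \<le> card ((\<lambda>j. insert (Suc N) (S j)) ` {..<m} \<union> Pow ?I)"
        unfolding ptf_length_def by (intro card_mono) auto
      also have "\<dots> \<le> card ((\<lambda>j. insert (Suc N) (S j)) ` {..<m}) + card (Pow ?I)"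
        by (rule card_Un_le)
      also have "\<dots> \<le> m + 2 ^ N"
        using card_image_le[of "{..<m}" "\<lambda>j. insert (Suc N) (S j)"] by (simp add: card_Pow)
      finally show ?thesis .
    qed
    show "ptf_weight (Suc N) w \<le> (W + 1) * 2 ^ N * (1 + real m) + W"
    proof -
      have "ptf_weight (Suc N) w = (\<Sum>T\<in>Pow ?I. \<bar>a T\<bar>) + (\<Sum>T\<in>Pow ?I. \<bar>b T\<bar>)"
        unfolding ptf_weight_def sum_Pow_Suc by (simp add: w_a w_b)
      \<comment> \<open>Every coefficient of \<open>a\<close> gets at most \<open>m\<close> from
        \<open>A\<close>; the constant term adds \<open>2 ^ N\<close> only once, at the empty
        set.\<close>
      also have "(\<Sum>T\<in>Pow ?I. \<bar>a T\<bar>) \<le> (\<Sum>T\<in>Pow ?I. (W + 1) * ((if T = {} then 2 ^ N else 0) + real m))"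
      proof (rule sum_mono)
        fix T assume T: "T \<in> Pow ?I"
        have "\<bar>\<Sum>p\<in>A. prod p T\<bar> \<le> (\<Sum>p\<in>A. \<bar>prod p T\<bar>)" by (rule sum_abs)
        also have "\<dots> = (\<Sum>p\<in>A. 1)"
          using A T by (intro sum.cong refl abs_prod_sign sign) auto
        finally have "\<bar>\<Sum>p\<in>A. prod p T\<bar> \<le> real m" by (simp add: card_A)
        then have "\<bar>(if T = {} then 2 ^ N else 0) - (\<Sum>p\<in>A. prod p T)\<bar> \<le> (if T = {} then 2 ^ N else 0) + real m"
          by (intro order_trans[OF abs_triangle_ineq4]) auto
        then show "\<bar>a T\<bar> \<le> (W + 1) * ((if T = {} then 2 ^ N else 0) + real m)"
          unfolding a_def abs_mult using W0 by (intro mult_mono) auto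
      qed
      also have "\<dots> = (W + 1) * (2 ^ N + 2 ^ N * real m)"
        by (simp add: sum.distrib card_Pow flip: sum_distrib_left)
      also have "(\<Sum>T\<in>Pow ?I. \<bar>b T\<bar>) \<le> (\<Sum>T\<in>Pow ?I. \<Sum>j<m. if S j = T then \<bar>c j\<bar> else 0)"
        unfolding b_def by (intro sum_mono order_trans[OF sum_abs]) (auto intro!: sum_mono)
      also have "\<dots> = W"
        unfolding W_def by (subst sum.swap) (use S in \<open>auto intro!: sum.cong\<close>)
      finally show ?thesis by (simp add: algebra_simps)
    qed
    show "W \<le> 2 * real m * sqrt (real m ^ m) / 2 ^ m" using c_sum by (simp add: W_def)
  qed
qed

section \<open>Numerical estimate of the weight\<close>

text \<open>Its square root bounds \<open>sqrt (real m ^ m) / 2 ^ m\<close> below by 1/2. The factor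
  4 is attained at \<open>m = 1\<close> and \<open>m = 2\<close>.\<close>

lemma four_power_le: "(4 :: nat) ^ m \<le> 4 * m ^ m" if "1 \<le> m"
proof (cases "m \<ge> 4")
  case True
  then have "(4 :: nat) ^ m \<le> m ^ m" by (rule power_mono) simp
  then show ?thesis by linarith
next
  case False
  then have "m = 1 \<or> m = 2 \<or> m = 3" using that by linarith
  then show ?thesis by auto
qed

text \<open>With \<open>X = 2 ^ N\<close> and \<open>Q = sqrt (real m ^ m) / 2 ^ m\<close>, the
  right side is \<open>12 * X * X * Q * m * sqrt m\<close>, while the left side is at most
  \<open>10 * m * m * Q * X\<close>.\<close>

lemma weight_estimate:
  fixes W :: real
  assumes m: "1 \<le> m" and mN: "2 * real m \<le> 2 ^ N"
    and W: "W \<le> 2 * real m * sqrt (real m ^ m) / 2 ^ m"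
  shows "(W + 1) * 2 ^ N * (1 + real m) + W
    \<le> 3 * 2 powr (2 * real (Suc N) + 1/2 * real m * log 2 (real m) - real m + 3/2 * log 2 (real m))"
proof -
  define Q where "Q = sqrt (real m ^ m) / 2 ^ m"
  define X :: real where "X = 2 ^ N"
  have m1: "1 \<le> real m" using m by simp
  have X1: "1 \<le> X" and X2: "2 * real m \<le> X" using mN by (simp_all add: X_def)
  have "2 powr (1/2 * real m * log 2 (real m)) = (2 powr log 2 (real m)) powr (1/2 * real m)"
    by (simp add: powr_powr mult_ac)
  also have "\<dots> = sqrt (real m ^ m)"
    using m1 by (simp add: powr_half_sqrt[symmetric] powr_powr powr_realpow[symmetric] mult_ac)
  finally have e1: "2 powr (1/2 * real m * log 2 (real m)) = sqrt (real m ^ m)" .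
  have "2 powr (3/2 * log 2 (real m)) = (2 powr log 2 (real m)) powr (1 + 1/2)"
    by (simp add: powr_powr mult_ac)
  also have "\<dots> = real m * sqrt (real m)"
    using m1 by (simp only: powr_add) (simp add: powr_half_sqrt)
  finally have e2: "2 powr (3/2 * log 2 (real m)) = real m * sqrt (real m)" .
  have e3: "2 powr (2 * real (Suc N)) = 4 * (X * X)"
  proof -
    have "2 powr (2 * real (Suc N)) = 2 powr real (Suc N + Suc N)" by simp
    also have "\<dots> = 2 ^ (Suc N + Suc N)" by (rule powr_realpow) simp
    also have "\<dots> = 4 * (X * X)" by (simp only: power_add) (simp add: X_def)
    finally show ?thesis .
  qed
  have e4: "2 powr real m = (2 :: real) ^ m" by (simp add: powr_realpow)
  have rhs: "2 powr (2 * real (Suc N) + 1/2 * real m * log 2 (real m) - real m + 3/2 * log 2 (real m))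
      = 4 * (X * X) * Q * (real m * sqrt (real m))"
    unfolding powr_add powr_diff e1 e2 e3 e4 Q_def by simp
  have "real (4 ^ m) \<le> real (4 * m ^ m)" using four_power_le[OF m] by (rule of_nat_mono)
  moreover have "(2 ^ m)\<^sup>2 = (4 :: real) ^ m"
    by (simp add: power2_eq_square flip: power_mult_distrib)
  ultimately have "sqrt ((2 ^ m)\<^sup>2) \<le> sqrt (2\<^sup>2 * real m ^ m)"
    by (intro real_sqrt_le_mono) simp
  then have Q: "1 \<le> 2 * Q" by (simp add: Q_def real_sqrt_mult field_simps)
  have mQ: "1 \<le> 2 * real m * Q"
    using mult_mono[OF m1 Q] m1 by (simp add: mult_ac)
  have W': "W \<le> 2 * real m * Q" using W by (simp add: Q_def)
  \<comment> \<open>Both \<open>W\<close> and 1 are at most \<open>2 * real m * Q\<close>, and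
    \<open>1 + real m\<close> is at most \<open>2 * real m\<close>. This gives 8 of the 10 units;
    the lone summand \<open>W\<close> gives the other 2.\<close>
  have "(W + 1) * X * (1 + real m) \<le> (4 * real m * Q) * X * (2 * real m)"
    using W' mQ m1 X1 Q by (intro mult_mono) auto
  moreover have "W \<le> 2 * real m * Q * (real m * X)"
  proof -
    have "1 \<le> real m * X" using mult_mono[OF m1 X1] m1 by simp
    then have "2 * real m * Q * 1 \<le> 2 * real m * Q * (real m * X)"
      using mQ Q by (intro mult_left_mono) auto
    then show ?thesis using W' by simp
  qed
  ultimately have "(W + 1) * X * (1 + real m) + W \<le> 10 * (real m * Q * X) * real m"
    by (simp add: algebra_simps)
  also have "\<dots> \<le> 12 * (real m * Q * X) * (X * sqrt (real m))"
  proof (intro mult_mono)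
    have "real m * 1 \<le> X * sqrt (real m)" using X2 m1 by (intro mult_mono) auto
    then show "real m \<le> X * sqrt (real m)" by simp
  qed (use Q X1 in auto)
  finally show ?thesis unfolding rhs by (simp add: X_def mult_ac)
qed

section \<open>Choice of the minority value and conclusion\<close>

theorem mainTheorem7:
  fixes n m :: nat and f :: "(nat \<Rightarrow> real) \<Rightarrow> real"
  assumes "n \<ge> 1"
    and "boolean_function n f"
    and "sparse n m f"
    and "1 \<le> m"
    and "real m \<le> 2 powr (real n - 2)"
  shows "\<exists>w :: nat set \<Rightarrow> real.
      (\<forall>S \<in> Pow {1..n}. w S \<in> \<int>) \<and>
      ptf_represents n w f \<and>
      ptf_length n w \<le> m + 2 ^ (n - 1) \<and>
      ptf_weight n w \<le>
        3 * 2 powr (2 * real n + 1/2 * real m * log 2 (real m) - real m + 3/2 * log 2 (real m))"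
proof -
  obtain N where n: "n = Suc N" using assms(1) by (cases n) auto
  \<comment> \<open>\<open>- \<sigma>\<close> is a value taken exactly \<open>m\<close> times.
    Multiplying \<open>w\<close> by \<open>\<sigma>\<close> fixes the sign of the polynomial and
    preserves integrality, length and weight.\<close>
  obtain \<sigma> :: real where \<sigma>: "\<sigma> \<in> {-1, 1}" and card: "card {x \<in> cube n. f x = - \<sigma>} = m"
  proof (cases "m = card {x \<in> cube n. f x = -1}")
    case True
    then show ?thesis using that[of 1] by simp
  next
    case False
    then have "m = card {x \<in> cube n. f x = 1}"
      using assms(3) by (auto simp: sparse_def min_def split: if_splits)
    then show ?thesis using that[of "-1"] by simp
  qed
  define A where "A = {x \<in> cube n. f x = - \<sigma>}"
  \<comment> \<open>The exponent is real, so no truncated subtraction occurs; in terms of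
    \<open>N = n - 1\<close> the bound on \<open>m\<close> reads
    \<open>2 * real m \<le> 2 ^ N\<close>.\<close>
  have "real n - 2 = real N - 1" by (simp add: n)
  then have "real m \<le> 2 powr (real N - 1)" using assms(5) by simp
  then have mN: "2 * real m \<le> 2 ^ N" by (simp add: powr_diff powr_realpow)
  then have "real (2 * m) \<le> real (2 ^ N)" by simp
  then have "2 * m \<le> 2 ^ N" by (simp only: of_nat_le_iff)
  then have mN': "m \<le> 2 ^ N" by simp
  have "A \<subseteq> cube (Suc N)" "card A = m" using card by (auto simp: A_def n)
  then obtain w W where w: "\<And>S. S \<subseteq> {1..Suc N} \<Longrightarrow> w S \<in> \<int>"
    and sgn_w: "\<And>x. x \<in> cube (Suc N) \<Longrightarrow> sgn (multilin_eval (Suc N) w x) = (if x \<in> A then -1 else 1)"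
    and len: "ptf_length (Suc N) w \<le> m + 2 ^ N"
    and wt: "ptf_weight (Suc N) w \<le> (W + 1) * 2 ^ N * (1 + real m) + W"
    and W: "W \<le> 2 * real m * sqrt (real m ^ m) / 2 ^ m"
    using ptf_separating_set[of A N m] assms(4) mN' by blast
  show ?thesis
  proof (intro exI conjI ballI)
    show "\<sigma> * w S \<in> \<int>" if "S \<in> Pow {1..n}" for S
      using w[of S] that \<sigma> by (auto simp: n)
    show "ptf_represents n (\<lambda>S. \<sigma> * w S) f"
      unfolding ptf_represents_def
    proof
      fix x assume x: "x \<in> cube n"
      then have "f x \<in> {-1, 1}" using assms(2) by (auto simp: boolean_function_def)
      moreover have "multilin_eval n (\<lambda>S. \<sigma> * w S) x = \<sigma> * multilin_eval (Suc N) w x"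
        by (simp add: multilin_eval_def n sum_distrib_left mult.assoc)
      moreover have "sgn \<sigma> = \<sigma>" using \<sigma> by auto
      ultimately show "f x = sgn (multilin_eval n (\<lambda>S. \<sigma> * w S) x)"
        using sgn_w[of x] x \<sigma> by (auto simp: sgn_mult A_def n)
    qed
    show "ptf_length n (\<lambda>S. \<sigma> * w S) \<le> m + 2 ^ (n - 1)"
      using len \<sigma> by (auto simp: ptf_length_def n)
    have "ptf_weight n (\<lambda>S. \<sigma> * w S) = ptf_weight (Suc N) w"
      using \<sigma> by (auto simp: ptf_weight_def n abs_mult)
    then show "ptf_weight n (\<lambda>S. \<sigma> * w S)
        \<le> 3 * 2 powr (2 * real n + 1/2 * real m * log 2 (real m) - real m + 3/2 * log 2 (real m))"
      using wt weight_estimate[OF assms(4) mN W] by (simp only: n)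
  qed
qed

end
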